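(* Let $\mathbb F$ be a field of characteristic $2$, let $(A,L,[\cdot,\cdot],(\cdot)^{[2]},\rho)$ be a restricted Lie-Rinehart algebra over $\mathbb F$ with associated restricted multiderivation $(m,\omega)=([\cdot,\cdot],(\cdot)^{[2]})$, and let $(m_t,\omega_t)$ be a restricted formal deformation of $(m,\omega)$. Then $(m_1,\omega_1)$ is a $2$-cocycle of the restricted cohomology, that is, $d^2_{CE}m_1=0$ and $\delta^2\omega_1=0$.
   Context: All algebras are finite-dimensional. **Restricted Lie algebra (char 2).** A Lie algebra $L$ with a map $(\cdot)^{[2]}$ such that $(\lambda x)^{[2]}=\lambda^2x^{[2]}$, $[x,y^{[2]}]=[[x,y],y]$, $(x+y)^{[2]}=x^{[2]}+y^{[2]}+[x,y]$. **Restricted Lie-Rinehart algebra (char 2).** $A$ is a commutative associative $\mathbb F$-algebra, $L$ is a restricted Lie algebra and an $A$-module, $\rho:L\to\mathrm{Der}(A)$ is a morphism of Lie algebras and of $A$-modules, $[x,ay]=\rho(x)(a)y+a[x,y]$, $\rho(x^{[2]})=\rho(x)^2$, $(ax)^{[2]}=a^2x^{[2]}+\rho(ax)(a)x$. **Restricted multiderivation (char 2).** A pair $(m,\omega)$, $m:L\times L\to L$ skew-symmetric bilinear, $\omega:L\to L$ with $\omega(\lambda x)=\lambda^2\omega(x)$ and $\omega(x+y)=\omega(x)+\omega(y)+m(x,y)$, such that there is a symbol map $\sigma:L\to\mathrm{Der}(A)$ with $\sigma(ax)=a\sigma(x)$, $m(x,ay)=am(x,y)+\sigma(x)(a)y$,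 $\sigma(\omega(x))=\sigma(x)^2$, $\omega(ax)=a^2\omega(x)+\sigma(ax)(a)x$. **Restricted formal deformation of $(m,\omega)$.** $m_t=\sum_{i\ge0}t^im_i:L\times L\to L[[t]]$, $\omega_t=\sum_{j\ge0}t^j\omega_j:L\to L[[t]]$ with $m_0=m$, $\omega_0=\omega$, each $(m_i,\omega_i)$ a restricted multiderivation with symbol map $\sigma_i$ ($\sigma_0=\rho$), such that for all $x,y,z\in L$: $m_t(x,m_t(y,z))+m_t(y,m_t(z,x))+m_t(z,m_t(x,y))=0$; $m_t(x,\omega_t(y))=m_t(m_t(x,y),y)$; $\omega_t(x+y)=\omega_t(x)+\omega_t(y)+m_t(x,y)$; $\sum_{i=0}^k\sigma_i(\omega_{k-i}(x))=\sum_{i=0}^k\sigma_i(x)\circ\sigma_{k-i}(x)$ for all $k\ge0$. ($m_t$ is extended $\mathbb F[[t]]$-bilinearly to $L[[t]]$.) **Differentials (adjoint coefficients, char 2).** For $(\varphi,w)$ with $\varphi:L\times L\to L$ alternating bilinear and $w:L\to L$ satisfying $w(\lambda x)=\lambda^2w(x)$, $w(x+y)=w(x)+w(y)+\varphi(x,y)$: $d^2_{CE}\varphi(x,y,z)=\varphi([x,y],z)+\varphi([x,z],y)+\varphi([y,z],x)+[x,\varphi(y,z)]+[y,\varphi(x,z)]+[z,\varphi(x,y)]$ and $\delta^2w(x,z)=[x,\varphi(x,z)]+[z,w(x)]+\varphi(x^{[2]},z)+\varphi([x,z],x)$. For $(\varphi,w)=(m_1,\omega_1)$, $\delta^2\omega_1$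 is formed with $\varphi=m_1$. *)

theory Defs
  imports "HOL-Computational_Algebra.Formal_Power_Series"
begin

unbundle fps_syntax

(* Underlying F-vector spaces are types of class ab_group_add together with a scalar
   multiplication by the field 'f. *)

definition fin_dim :: "('f::field \<Rightarrow> 'v::ab_group_add \<Rightarrow> 'v) \<Rightarrow> bool" where
  "fin_dim s \<longleftrightarrow> (\<exists>B. finite B \<and> module.span s B = UNIV)"

definition bilinear_map :: "('f::field \<Rightarrow> 'v::ab_group_add \<Rightarrow> 'v) \<Rightarrow> ('v \<Rightarrow> 'v \<Rightarrow> 'v) \<Rightarrow> bool" where
  "bilinear_map s m \<longleftrightarrow>
     (\<forall>x. Vector_Spaces.linear s s (m x)) \<and> (\<forall>y. Vector_Spaces.linear s s (\<lambda>x. m x y))"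

locale lie_algebra = vector_space sL
  for sL :: "'f::field \<Rightarrow> 'l::ab_group_add \<Rightarrow> 'l" +
  fixes br :: "'l \<Rightarrow> 'l \<Rightarrow> 'l"
  assumes br_bilinear: "bilinear_map sL br"
    and br_alternating: "br x x = 0"
    and br_jacobi: "br x (br y z) + br y (br z x) + br z (br x y) = 0"

(* The p-map axioms are those for p = 2. *)
locale restricted_lie_algebra = lie_algebra sL br
  for sL :: "'f::field \<Rightarrow> 'l::ab_group_add \<Rightarrow> 'l" and br +
  fixes sq :: "'l \<Rightarrow> 'l"
  assumes sq_scale: "sq (sL c x) = sL (c\<^sup>2) (sq x)"
    and br_sq: "br x (sq y) = br (br x y) y"
    and sq_add: "sq (x + y) = sq x + sq y + br x y"

(* The class comm_ring does not ask for a unit; commutativity and associativity of the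
   product come from the class. *)
locale commutative_algebra = vector_space sA
  for sA :: "'f::field \<Rightarrow> 'a::comm_ring \<Rightarrow> 'a" +
  assumes scale_mult: "sA c (a * b) = sA c a * b"

definition derivation :: "('f::field \<Rightarrow> 'a::comm_ring \<Rightarrow> 'a) \<Rightarrow> ('a \<Rightarrow> 'a) \<Rightarrow> bool" where
  "derivation sA D \<longleftrightarrow>
     Vector_Spaces.linear sA sA D \<and> (\<forall>a b. D (a * b) = D a * b + a * D b)"

(* act is the A-module structure of L. The library locale "module" needs a unital ring, so
   the axioms are spelled out; the last axiom on act says that it is compatible with the two
   F-structures. *)
locale restricted_lie_rinehart =
  A: commutative_algebra sA + L: restricted_lie_algebra sL br sq
  for sA :: "'f::field \<Rightarrow> 'a::comm_ring \<Rightarrow> 'a"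
    and sL :: "'f \<Rightarrow> 'l::ab_group_add \<Rightarrow> 'l" and br and sq +
  fixes act :: "'a \<Rightarrow> 'l \<Rightarrow> 'l" and \<rho> :: "'l \<Rightarrow> 'a \<Rightarrow> 'a"
  assumes A_fin_dim: "fin_dim sA"
    and L_fin_dim: "fin_dim sL"
    and act_add_left: "act (a + b) x = act a x + act b x"
    and act_add_right: "act a (x + y) = act a x + act a y"
    and act_mult: "act (a * b) x = act a (act b x)"
    and act_scale: "act (sA c a) x = sL c (act a x)" "act a (sL c x) = sL c (act a x)"
    and anchor_derivation: "derivation sA (\<rho> x)"
    and anchor_add: "\<rho> (x + y) a = \<rho> x a + \<rho> y a"
    and anchor_scale: "\<rho> (sL c x) a = sA c (\<rho> x a)"
    and anchor_bracket: "\<rho> (br x y) a = \<rho> x (\<rho> y a) - \<rho> y (\<rho> x a)"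
    and anchor_act: "\<rho> (act b x) a = b * \<rho> x a"
    and leibniz: "br x (act a y) = act (\<rho> x a) y + act a (br x y)"
    and anchor_sq: "\<rho> (sq x) a = \<rho> x (\<rho> x a)"
    and sq_act: "sq (act a x) = act (a * a) (sq x) + act (\<rho> (act a x) a) x"

definition symbol_of ::
  "('f::field \<Rightarrow> 'a::comm_ring \<Rightarrow> 'a) \<Rightarrow> ('a \<Rightarrow> 'l::ab_group_add \<Rightarrow> 'l) \<Rightarrow>
   ('l \<Rightarrow> 'l \<Rightarrow> 'l) \<Rightarrow> ('l \<Rightarrow> 'l) \<Rightarrow> ('l \<Rightarrow> 'a \<Rightarrow> 'a) \<Rightarrow> bool" where
  "symbol_of sA act m \<omega> \<sigma> \<longleftrightarrow>
     (\<forall>x. derivation sA (\<sigma> x)) \<and>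
     (\<forall>a b x. \<sigma> (act a x) b = a * \<sigma> x b) \<and>
     (\<forall>x a y. m x (act a y) = act a (m x y) + act (\<sigma> x a) y) \<and>
     (\<forall>x a. \<sigma> (\<omega> x) a = \<sigma> x (\<sigma> x a)) \<and>
     (\<forall>a x. \<omega> (act a x) = act (a * a) (\<omega> x) + act (\<sigma> (act a x) a) x)"

definition restricted_multiderivation_with_symbol ::
  "('f::field \<Rightarrow> 'a::comm_ring \<Rightarrow> 'a) \<Rightarrow> ('f \<Rightarrow> 'l::ab_group_add \<Rightarrow> 'l) \<Rightarrow> ('a \<Rightarrow> 'l \<Rightarrow> 'l) \<Rightarrow>
   ('l \<Rightarrow> 'l \<Rightarrow> 'l) \<Rightarrow> ('l \<Rightarrow> 'l) \<Rightarrow> ('l \<Rightarrow> 'a \<Rightarrow> 'a) \<Rightarrow> bool" where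
  "restricted_multiderivation_with_symbol sA sL act m \<omega> \<sigma> \<longleftrightarrow>
     bilinear_map sL m \<and>
     (\<forall>x y. m x y = - m y x) \<and>
     (\<forall>c x. \<omega> (sL c x) = sL (c\<^sup>2) (\<omega> x)) \<and>
     (\<forall>x y. \<omega> (x + y) = \<omega> x + \<omega> y + m x y) \<and>
     symbol_of sA act m \<omega> \<sigma>"

(* L[[t]] is the type of formal power series with coefficients in L. For
   m_t = sum_k t^k m_k : L x L -> L[[t]], with m_k x y = mt x y $ k, the F[[t]]-bilinear
   extension sends (sum_i t^i x_i, sum_j t^j y_j) to the sum of t^(i+j+k) m_k(x_i, y_j). *)
definition fps_extend ::
  "('l \<Rightarrow> 'l \<Rightarrow> 'l fps) \<Rightarrow> 'l::ab_group_add fps \<Rightarrow> 'l fps \<Rightarrow> 'l fps" where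
  "fps_extend mt X Y =
     Abs_fps (\<lambda>n. \<Sum>k\<le>n. \<Sum>i\<le>n - k. mt (X $ i) (Y $ (n - k - i)) $ k)"

definition restricted_formal_deformation ::
  "('f::field \<Rightarrow> 'a::comm_ring \<Rightarrow> 'a) \<Rightarrow> ('f \<Rightarrow> 'l::ab_group_add \<Rightarrow> 'l) \<Rightarrow> ('a \<Rightarrow> 'l \<Rightarrow> 'l) \<Rightarrow>
   ('l \<Rightarrow> 'l \<Rightarrow> 'l) \<Rightarrow> ('l \<Rightarrow> 'l) \<Rightarrow> ('l \<Rightarrow> 'a \<Rightarrow> 'a) \<Rightarrow>
   ('l \<Rightarrow> 'l \<Rightarrow> 'l fps) \<Rightarrow> ('l \<Rightarrow> 'l fps) \<Rightarrow> bool" where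
  "restricted_formal_deformation sA sL act m \<omega> \<rho> mt \<omega>t \<longleftrightarrow>
     (\<forall>x y. mt x y $ 0 = m x y) \<and>
     (\<forall>x. \<omega>t x $ 0 = \<omega> x) \<and>
     (\<forall>x y z. fps_extend mt (fps_const x) (mt y z) + fps_extend mt (fps_const y) (mt z x)
              + fps_extend mt (fps_const z) (mt x y) = 0) \<and>
     (\<forall>x y. fps_extend mt (fps_const x) (\<omega>t y) = fps_extend mt (mt x y) (fps_const y)) \<and>
     (\<forall>x y. \<omega>t (x + y) = \<omega>t x + \<omega>t y + mt x y) \<and>
     (\<exists>\<sigma>. \<sigma> 0 = \<rho> \<and>
        (\<forall>i. restricted_multiderivation_with_symbol sA sL act
               (\<lambda>x y. mt x y $ i) (\<lambda>x. \<omega>t x $ i) (\<sigma> i)) \<and>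
        (\<forall>k x a. (\<Sum>i\<le>k. \<sigma> i (\<omega>t x $ (k - i)) a) = (\<Sum>i\<le>k. \<sigma> i x (\<sigma> (k - i) x a))))"

definition restricted_2cochain ::
  "('f::field \<Rightarrow> 'l::ab_group_add \<Rightarrow> 'l) \<Rightarrow> ('l \<Rightarrow> 'l \<Rightarrow> 'l) \<Rightarrow> ('l \<Rightarrow> 'l) \<Rightarrow> bool" where
  "restricted_2cochain sL \<phi> w \<longleftrightarrow>
     bilinear_map sL \<phi> \<and> (\<forall>x. \<phi> x x = 0) \<and>
     (\<forall>c x. w (sL c x) = sL (c\<^sup>2) (w x)) \<and>
     (\<forall>x y. w (x + y) = w x + w y + \<phi> x y)"

(* Signs are omitted in both differentials: the characteristic is 2. *)
definition d2_CE ::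
  "('l::ab_group_add \<Rightarrow> 'l \<Rightarrow> 'l) \<Rightarrow> ('l \<Rightarrow> 'l \<Rightarrow> 'l) \<Rightarrow> 'l \<Rightarrow> 'l \<Rightarrow> 'l \<Rightarrow> 'l" where
  "d2_CE br \<phi> x y z =
     \<phi> (br x y) z + \<phi> (br x z) y + \<phi> (br y z) x
     + br x (\<phi> y z) + br y (\<phi> x z) + br z (\<phi> x y)"

definition delta2 ::
  "('l::ab_group_add \<Rightarrow> 'l \<Rightarrow> 'l) \<Rightarrow> ('l \<Rightarrow> 'l) \<Rightarrow>
   ('l \<Rightarrow> 'l \<Rightarrow> 'l) \<Rightarrow> ('l \<Rightarrow> 'l) \<Rightarrow> 'l \<Rightarrow> 'l \<Rightarrow> 'l" where
  "delta2 br sq \<phi> w x z =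
     br x (\<phi> x z) + br z (w x) + \<phi> (sq x) z + \<phi> (br x z) x"

definition restricted_2cocycle ::
  "('f::field \<Rightarrow> 'l::ab_group_add \<Rightarrow> 'l) \<Rightarrow> ('l \<Rightarrow> 'l \<Rightarrow> 'l) \<Rightarrow> ('l \<Rightarrow> 'l) \<Rightarrow>
   ('l \<Rightarrow> 'l \<Rightarrow> 'l) \<Rightarrow> ('l \<Rightarrow> 'l) \<Rightarrow> bool" where
  "restricted_2cocycle sL br sq \<phi> w \<longleftrightarrow>
     restricted_2cochain sL \<phi> w \<and>
     (\<forall>x y z. d2_CE br \<phi> x y z = 0) \<and> (\<forall>x z. delta2 br sq \<phi> w x z = 0)"

end

theory Submission
  imports Defs
begin

text \<open>Both deformation identities are compared at order \<open>t\<close>. A single factor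
  \<open>t\<close> can come from the second argument, the first argument or the bracket itself, so
  only orders 0 and 1 of \<open>mt\<close> enter.\<close>

lemma fps_extend_nth_1:
  "fps_extend mt X Y $ 1 =
     mt (X $ 0) (Y $ 1) $ 0 + mt (X $ 1) (Y $ 0) $ 0 + mt (X $ 0) (Y $ 0) $ 1"
  by (simp add: fps_extend_def)

text \<open>This is how characteristic 2 enters: signs disappear, and an equation
  \<open>u = v\<close> can be read as \<open>u + v = 0\<close>.\<close>

lemma (in vector_space) char_2_add_self:
  fixes v :: 'b
  assumes "CHAR('a) = 2"
  shows "v + v = 0"
proof -
  have "of_nat 2 = (0 :: 'a)"
    unfolding assms[symmetric] by (rule of_nat_CHAR)
  then have "scale (1 + 1) v = 0"
    by simp
  then show ?thesis
    by (simp only: scale_left_distrib scale_one)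
qed

lemma bilinear_map_zero:
  assumes "bilinear_map s m"
  shows "m x 0 = 0" "m 0 x = 0"
proof -
  interpret r: Vector_Spaces.linear s s "m x"
    using assms by (simp add: bilinear_map_def)
  interpret l: Vector_Spaces.linear s s "\<lambda>y. m y x"
    using assms by (simp add: bilinear_map_def)
  show "m x 0 = 0" "m 0 x = 0"
    by (fact r.zero) (fact l.zero)
qed

text \<open>The alternating property comes from \<open>\<omega>\<close>: skew-symmetry alone does not give it in
  characteristic 2, whereas \<open>0 = \<omega> (x + x) = 2 \<omega> x + m x x\<close> does.\<close>

lemma restricted_multiderivation_2cochain:
  fixes sL :: "'f::field \<Rightarrow> 'l::ab_group_add \<Rightarrow> 'l"
  assumes "CHAR('f) = 2" "vector_space sL"
    and md: "restricted_multiderivation_with_symbol sA sL act m \<omega> \<sigma>"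
  shows "restricted_2cochain sL m \<omega>"
proof -
  interpret vector_space sL by fact
  note double = char_2_add_self[OF assms(1)]
  have scale: "\<omega> (sL c x) = sL (c\<^sup>2) (\<omega> x)"
    and add: "\<omega> (x + y) = \<omega> x + \<omega> y + m x y" for c x y
    using md unfolding restricted_multiderivation_with_symbol_def by blast+
  have "\<omega> 0 = 0"
    using scale[of 0 0] by simp
  then have "m x x = 0" for x
    using add[of x x] by (simp add: double)
  then show ?thesis
    using md unfolding restricted_multiderivation_with_symbol_def restricted_2cochain_def by blast
qed

text \<open>Every vector is its own negative, so skew-symmetry becomes symmetry. Applied to each
  coefficient of \<open>mt\<close>, this allows arguments to be swapped freely to match the unsigned
  differentials.\<close>

lemma restricted_multiderivation_commute:
  fixes sL :: "'f::field \<Rightarrow> 'l::ab_group_add \<Rightarrow> 'l"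
  assumes "CHAR('f) = 2" "vector_space sL"
    and "restricted_multiderivation_with_symbol sA sL act m \<omega> \<sigma>"
  shows "m x y = m y x"
proof -
  have "m x y = - m y x"
    using assms(3) unfolding restricted_multiderivation_with_symbol_def by blast
  also have "\<dots> = m y x"
    using vector_space.char_2_add_self[OF assms(2,1)] by (rule minus_unique)
  finally show ?thesis .
qed

theorem proposition5p16:
  fixes sA :: "'f::field \<Rightarrow> 'a::comm_ring \<Rightarrow> 'a"
    and sL :: "'f \<Rightarrow> 'l::ab_group_add \<Rightarrow> 'l"
    and br :: "'l \<Rightarrow> 'l \<Rightarrow> 'l" and sq :: "'l \<Rightarrow> 'l"
    and act :: "'a \<Rightarrow> 'l \<Rightarrow> 'l" and \<rho> :: "'l \<Rightarrow> 'a \<Rightarrow> 'a"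
    and mt :: "'l \<Rightarrow> 'l \<Rightarrow> 'l fps" and \<omega>t :: "'l \<Rightarrow> 'l fps"
  assumes "CHAR('f) = 2"
    and "restricted_lie_rinehart sA sL br sq act \<rho>"
    and "restricted_formal_deformation sA sL act br sq \<rho> mt \<omega>t"
  shows "restricted_2cocycle sL br sq (\<lambda>x y. mt x y $ 1) (\<lambda>x. \<omega>t x $ 1)"
proof -
  interpret restricted_lie_rinehart sA sL br sq act \<rho> by fact
  let ?m = "\<lambda>x y. mt x y $ 1" and ?w = "\<lambda>x. \<omega>t x $ 1"
  note double = L.char_2_add_self[OF assms(1)]
  have vs: "vector_space sL" by unfold_locales
  from assms(3) obtain \<sigma> where
    md: "\<And>i. restricted_multiderivation_with_symbol sA sL act
           (\<lambda>x y. mt x y $ i) (\<lambda>x. \<omega>t x $ i) (\<sigma> i)"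
    unfolding restricted_formal_deformation_def by blast
  have m0: "mt x y $ 0 = br x y" and w0: "\<omega>t x $ 0 = sq x"
    and jacobi: "fps_extend mt (fps_const x) (mt y z) + fps_extend mt (fps_const y) (mt z x)
              + fps_extend mt (fps_const z) (mt x y) = 0"
    and square: "fps_extend mt (fps_const x) (\<omega>t y) = fps_extend mt (mt x y) (fps_const y)"
    for x y z
    using assms(3) by (simp_all add: restricted_formal_deformation_def)
  have m_commute: "mt x y $ i = mt y x $ i" for x y i
    using restricted_multiderivation_commute[OF assms(1) vs md] .
  have br_commute: "br x y = br y x" for x y
    using m_commute[of x y 0] by (simp add: m0)
  \<comment> \<open>A constant series has coefficient 0 at order 1. Each term of
    \<open>fps_extend_nth_1\<close> that takes this coefficient is a bracket \<open>br\<close> with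
    a zero argument and vanishes.\<close>
  note coeff1 = fps_extend_nth_1 m0 w0 bilinear_map_zero[OF L.br_bilinear]
  have "d2_CE br ?m x y z = 0" for x y z
  proof -
    \<comment> \<open>Order 1 of the Jacobi identity: these are the six terms of
      \<open>d2_CE\<close> up to the order of arguments, which symmetry of \<open>br\<close> and
      \<open>?m\<close> then adjusts.\<close>
    have "br x (?m y z) + ?m x (br y z) + (br y (?m z x) + ?m y (br z x))
        + (br z (?m x y) + ?m z (br x y)) = 0"
      using arg_cong[OF jacobi[of x y z], of "\<lambda>X. X $ 1"]
      by (simp add: coeff1 del: One_nat_def)
    then have "br x (?m y z) + ?m (br y z) x + (br y (?m x z) + ?m (br x z) y)
        + (br z (?m x y) + ?m (br x y) z) = 0"
      by (simp only: br_commute[of z x] m_commute[of z x] m_commute[of _ "br _ _"])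
    then show ?thesis
      by (simp only: d2_CE_def ac_simps)
  qed
  moreover have "delta2 br sq ?m ?w x z = 0" for x z
  proof -
    \<comment> \<open>The identity is taken at \<open>(z, x)\<close>, so that
      \<open>\<omega>t\<close> and \<open>sq\<close> are evaluated at \<open>x\<close>, as in
      \<open>delta2\<close>.\<close>
    have "br z (?w x) + ?m z (sq x) = br (?m z x) x + ?m (br z x) x"
      using arg_cong[OF square[of z x], of "\<lambda>X. X $ 1"]
      by (simp add: coeff1 del: One_nat_def)
    then have "br z (?w x) + ?m (sq x) z = br x (?m x z) + ?m (br x z) x"
      by (simp only: br_commute[of z x] m_commute[of z x] br_commute[of "?m x z" x]
          m_commute[of z "sq x"])
    \<comment> \<open>Replacing one side of the equation by the other leaves the sum of a vector
      with itself, which is zero.\<close>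
    then have "br x (?m x z) + ?m (br x z) x + (br z (?w x) + ?m (sq x) z) = 0"
      by (simp only: double)
    then show ?thesis
      by (simp only: delta2_def ac_simps)
  qed
  ultimately show ?thesis
    \<comment> \<open>Besides the two vanishing differentials, a cocycle must be a cochain; the
      order 1 multiderivation supplies this.\<close>
    using restricted_multiderivation_2cochain[OF assms(1) vs md, of 1]
    by (simp add: restricted_2cocycle_def)
qed

end
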